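(* Let $\mathsf{P}$ be a problem, and let ${}^1\mathsf{P}$ be its first-order part. (1) For every first-order problem $\mathsf{Q}$, if $\mathsf{Q} \leq_{\mathrm{W}} \mathsf{P}$ then $\mathsf{Q} \leq_{\mathrm{sW}} {}^1\mathsf{P}$. (2) ${}^1\mathsf{P} \equiv_{\mathrm{W}} \max_{\leq_{\mathrm{W}}} \{\mathsf{Q} : \mathsf{Q} \text{ is a first-order problem and } \mathsf{Q} \leq_{\mathrm{W}} \mathsf{P}\}$; that is, ${}^1\mathsf{P}$ is, up to Weihrauch equivalence, the $\leq_{\mathrm{W}}$-greatest first-order problem that is Weihrauch reducible to $\mathsf{P}$.
   Context: A problem is a partial multifunction $\mathsf{P} :\subseteq \omega^\omega \rightrightarrows \omega^\omega$. Each $f \in \mathrm{dom}(\mathsf{P})$ (so $\mathsf{P}(f) \neq \emptyset$) is a $\mathsf{P}$-instance, and each $g \in \mathsf{P}(f)$ is a $\mathsf{P}$-solution to $f$. The set $\omega$ is embedded in $\omega^\omega$ by identifying $x \in \omega$ with the $f \in \omega^\omega$ such that $f(0)=x$ and $f(y)=0$ for all $y>0$. Angle brackets denote Turing joins. Turing functionals are regarded as partial maps $\omega^\omega \to \omega^\omega$, $\Psi(f,g)$ means $\Psi(\langle f,g\rangle)$, and $\Psi(f)(x)$ is the value at $x$ of the computation with oracle $f$. When a Turing functional is part of an instance, it is given by an index in a fixed computable listing of all Turing functionals. $\mathsf{Q} \leq_{\mathrm{W}} \mathsf{P}$ (Weihrauch reducible) if there are Turing functionals $\Phi,\Psi$ such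 that for all $f \in \mathrm{dom}(\mathsf{Q})$ we have $\Phi(f) \in \mathrm{dom}(\mathsf{P})$, and for every $g \in \mathsf{P}(\Phi(f))$ we have $\Psi(f,g) \in \mathsf{Q}(f)$. $\mathsf{Q} \leq_{\mathrm{sW}} \mathsf{P}$ (strongly Weihrauch reducible) is defined the same way with $\Psi(g) \in \mathsf{Q}(f)$ in place of $\Psi(f,g) \in \mathsf{Q}(f)$. $\equiv_{\mathrm{W}}$ is the equivalence relation induced by $\leq_{\mathrm{W}}$. A problem $\mathsf{Q}$ is first-order if $\mathsf{Q}(f) \subseteq \omega$ for all $f \in \mathrm{dom}(\mathsf{Q})$. The first-order part ${}^1\mathsf{P}$ of a problem $\mathsf{P}$ is the following first-order problem. Its instances are all triples $\langle f,\Phi,\Psi\rangle$, where $f \in \omega^\omega$ and $\Phi,\Psi$ are Turing functionals such that $\Phi(f) \in \mathrm{dom}(\mathsf{P})$ and $\Psi(f,g)(0)\downarrow$ for all $g \in \mathsf{P}(\Phi(f))$. The solutions to such an instance are all $y \in \omega$ such that $\Psi(f,g)(0)\downarrow = y$ for some $g \in \mathsf{P}(\Phi(f))$. *)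

theory Defs
  imports Main "HOL-Library.Nat_Bijection"
begin

(* Turing functionals are presented as the Kleene partial recursive functionals: unary
   partial functions on nat, computed relative to g :: nat => nat, with several arguments
   combined by the Cantor pairing prod_encode. *)

datatype rcode =
    RZero | RSucc | RFst | RSnd | ROracle
  | RPair rcode rcode | RComp rcode rcode | RPrec rcode rcode | RMu rcode

primrec reval :: "rcode \<Rightarrow> (nat \<Rightarrow> nat) \<Rightarrow> nat \<Rightarrow> nat option" where
  "reval RZero g x = Some 0"
| "reval RSucc g x = Some (Suc x)"
| "reval RFst g x = Some (fst (prod_decode x))"
| "reval RSnd g x = Some (snd (prod_decode x))"
| "reval ROracle g x = Some (g x)"
| "reval (RPair a b) g x =
     Option.bind (reval a g x) (\<lambda>y. Option.bind (reval b g x) (\<lambda>z. Some (prod_encode (y, z))))"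
| "reval (RComp a b) g x = Option.bind (reval b g x) (reval a g)"
  (* on the pair (u, n): h(u, 0) = a(u) and h(u, n + 1) = b(u, (n, h(u, n))) *)
| "reval (RPrec a b) g x =
     rec_nat (reval a g (fst (prod_decode x)))
       (\<lambda>n r. Option.bind r
          (\<lambda>v. reval b g (prod_encode (fst (prod_decode x), prod_encode (n, v)))))
       (snd (prod_decode x))"
  (* unbounded search diverges if some value before the first zero is undefined *)
| "reval (RMu a) g x =
     (if \<exists>n. reval a g (prod_encode (x, n)) = Some 0 \<and>
             (\<forall>m<n. reval a g (prod_encode (x, m)) \<noteq> None)
      then Some (LEAST n. reval a g (prod_encode (x, n)) = Some 0)
      else None)"

(* A functional F is kept together with its pointwise values: F f x is the value at x
   with oracle f, None meaning divergence. *)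
type_synonym functional = "(nat \<Rightarrow> nat) \<Rightarrow> nat \<Rightarrow> nat option"

definition Turing_functional :: "functional \<Rightarrow> bool" where
  "Turing_functional F \<longleftrightarrow> (\<exists>c. F = reval c)"

(* F(f) = h as a partial map on Baire space: F(f) is defined only if it is total. *)
definition maps_to :: "functional \<Rightarrow> (nat \<Rightarrow> nat) \<Rightarrow> (nat \<Rightarrow> nat) \<Rightarrow> bool" where
  "maps_to F f h \<longleftrightarrow> (\<forall>x. F f x = Some (h x))"

lemma fst_prod_decode_le: "fst (prod_decode n) \<le> n"
  by (metis le_prod_encode_1 prod.collapse prod_decode_inverse)

lemma snd_prod_decode_le: "snd (prod_decode n) \<le> n"
  by (metis le_prod_encode_2 prod.collapse prod_decode_inverse)

(* The computable listing of all codes: 0, ..., 4 are the basic codes, and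
   5 + 4 * k + t is the t-th compound constructor with argument(s) coded by k. *)
function code_of :: "nat \<Rightarrow> rcode" where
  "code_of n =
    (if n = 0 then RZero else if n = 1 then RSucc else if n = 2 then RFst
     else if n = 3 then RSnd else if n = 4 then ROracle
     else let k = (n - 5) div 4; t = (n - 5) mod 4;
              i = fst (prod_decode k); j = snd (prod_decode k)
       in if t = 0 then RPair (code_of i) (code_of j)
          else if t = 1 then RComp (code_of i) (code_of j)
          else if t = 2 then RPrec (code_of i) (code_of j)
          else RMu (code_of k))"
  by auto
termination
  by (relation "measure id") (auto intro: le_less_trans[OF fst_prod_decode_le] le_less_trans[OF snd_prod_decode_le])

declare code_of.simps [simp del]

lemma surj_code_of: "surj code_of"
proof -
  have [simp]: "Suc (4 * k) div 4 = k" "Suc (Suc (4 * k)) div 4 = k"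
    "Suc (Suc (Suc (4 * k))) div 4 = k" "Suc (4 * k) mod 4 = 1"
    "Suc (Suc (4 * k)) mod 4 = 2" "Suc (Suc (Suc (4 * k))) mod 4 = 3"
    "(4 * k + 2) div 4 = k" "(4 * k + 3) div 4 = k"
    "(4 * k + 2) mod 4 = 2" "(4 * k + 3) mod 4 = 3" for k :: nat
    by presburger+
  have "\<exists>n. code_of n = c" for c
  proof (induction c)
    case RZero
    show ?case by (rule exI[of _ 0]) (simp add: code_of.simps)
  next
    case RSucc
    show ?case by (rule exI[of _ 1]) (simp add: code_of.simps)
  next
    case RFst
    show ?case by (rule exI[of _ 2]) (simp add: code_of.simps)
  next
    case RSnd
    show ?case by (rule exI[of _ 3]) (simp add: code_of.simps)
  next
    case ROracle
    show ?case by (rule exI[of _ 4]) (simp add: code_of.simps)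
  next
    case (RPair a b)
    then obtain i j where "code_of i = a" "code_of j = b" by blast
    then show ?case
      by (intro exI[of _ "5 + 4 * prod_encode (i, j)"]) (subst code_of.simps, simp add: Let_def)
  next
    case (RComp a b)
    then obtain i j where "code_of i = a" "code_of j = b" by blast
    then show ?case
      by (intro exI[of _ "5 + (4 * prod_encode (i, j) + 1)"])
        (subst code_of.simps, simp add: Let_def)
  next
    case (RPrec a b)
    then obtain i j where "code_of i = a" "code_of j = b" by blast
    then show ?case
      by (intro exI[of _ "5 + (4 * prod_encode (i, j) + 2)"])
        (subst code_of.simps, simp add: Let_def)
  next
    case (RMu a)
    then obtain k where "code_of k = a" by blast
    then show ?case
      by (intro exI[of _ "5 + (4 * k + 3)"]) (subst code_of.simps, simp add: Let_def)
  qed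
  then show ?thesis by (metis surjI)
qed

definition functional_of :: "nat \<Rightarrow> functional" where
  "functional_of e = reval (code_of e)"

lemma Turing_functional_iff_index: "Turing_functional F \<longleftrightarrow> (\<exists>e. F = functional_of e)"
  unfolding Turing_functional_def functional_of_def by (metis surj_code_of surjD)

definition join :: "(nat \<Rightarrow> nat) \<Rightarrow> (nat \<Rightarrow> nat) \<Rightarrow> nat \<Rightarrow> nat" where
  "join f g n = (if even n then f (n div 2) else g (n div 2))"

definition embed :: "nat \<Rightarrow> nat \<Rightarrow> nat" where
  "embed x = (\<lambda>y. if y = 0 then x else 0)"

(* The partial multifunction with value P f at f; f lies outside the domain iff P f = {}. *)
type_synonym problem = "(nat \<Rightarrow> nat) \<Rightarrow> (nat \<Rightarrow> nat) set"

definition pdom :: "problem \<Rightarrow> (nat \<Rightarrow> nat) set" where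
  "pdom P = {f. P f \<noteq> {}}"

definition Weihrauch_le :: "problem \<Rightarrow> problem \<Rightarrow> bool"  (infix "\<le>\<^sub>W" 50) where
  "Q \<le>\<^sub>W P \<longleftrightarrow>
    (\<exists>\<Phi> \<Psi>. Turing_functional \<Phi> \<and> Turing_functional \<Psi> \<and>
      (\<forall>f\<in>pdom Q. \<exists>h\<in>pdom P. maps_to \<Phi> f h \<and>
        (\<forall>g\<in>P h. \<exists>k\<in>Q f. maps_to \<Psi> (join f g) k)))"

definition strong_Weihrauch_le :: "problem \<Rightarrow> problem \<Rightarrow> bool"  (infix "\<le>\<^sub>s\<^sub>W" 50) where
  "Q \<le>\<^sub>s\<^sub>W P \<longleftrightarrow>
    (\<exists>\<Phi> \<Psi>. Turing_functional \<Phi> \<and> Turing_functional \<Psi> \<and>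
      (\<forall>f\<in>pdom Q. \<exists>h\<in>pdom P. maps_to \<Phi> f h \<and>
        (\<forall>g\<in>P h. \<exists>k\<in>Q f. maps_to \<Psi> g k)))"

definition Weihrauch_equiv :: "problem \<Rightarrow> problem \<Rightarrow> bool"  (infix "\<equiv>\<^sub>W" 50) where
  "Q \<equiv>\<^sub>W P \<longleftrightarrow> Q \<le>\<^sub>W P \<and> P \<le>\<^sub>W Q"

definition first_order :: "problem \<Rightarrow> bool" where
  "first_order Q \<longleftrightarrow> (\<forall>f\<in>pdom Q. Q f \<subseteq> range embed)"

(* i and j are the indices of the two functionals of the triple. *)
definition fop_instance :: "problem \<Rightarrow> (nat \<Rightarrow> nat) \<Rightarrow> nat \<Rightarrow> nat \<Rightarrow> bool" where
  "fop_instance P f i j \<longleftrightarrow>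
    (\<exists>h\<in>pdom P. maps_to (functional_of i) f h \<and>
      (\<forall>g\<in>P h. functional_of j (join f g) 0 \<noteq> None))"

(* The triple is coded by join f (join (embed i) (embed j)), an injective coding. *)
definition first_order_part :: "problem \<Rightarrow> problem" where
  "first_order_part P p =
    {embed y | y. \<exists>f i j. p = join f (join (embed i) (embed j)) \<and> fop_instance P f i j \<and>
       (\<exists>h g. maps_to (functional_of i) f h \<and> g \<in> P h \<and> functional_of j (join f g) 0 = Some y)}"

definition Weihrauch_greatest :: "problem set \<Rightarrow> problem \<Rightarrow> bool" where
  "Weihrauch_greatest S M \<longleftrightarrow> M \<in> S \<and> (\<forall>Q\<in>S. Q \<le>\<^sub>W M)"

end

theory Submission
  imports Defs
begin

text \<open>
  Part (1) holds because a first-order solution is determined by its value at 0, so the triple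
  consisting of an instance and the two given functionals already computes it.  The substance
  of part (2) is that the first-order part reduces to \<open>P\<close>, which needs a universal functional.
  It is obtained by iterating a computable one-step function of a stack machine whose states
  are numbers and whose stack holds the pending continuations, and by searching for the first
  stage at which the stack is empty.
\<close>

section \<open>Total computable functionals\<close>

text \<open>One code must converge at every oracle and input. Totality lets the closure rules speak
  of plain functions, without tracking undefinedness through \<open>option\<close>.\<close>

definition computable :: "((nat \<Rightarrow> nat) \<Rightarrow> nat \<Rightarrow> nat) \<Rightarrow> bool" where
  "computable F \<longleftrightarrow> (\<exists>c. \<forall>p x. reval c p x = Some (F p x))"

abbreviation "pair a b \<equiv> prod_encode (a, b)"
abbreviation "left n \<equiv> fst (prod_decode n)"
abbreviation "right n \<equiv> snd (prod_decode n)"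

named_theorems computable_intros

lemma computable_id [computable_intros]: "computable (\<lambda>p x. x)"
  unfolding computable_def by (rule exI[of _ "RPair RFst RSnd"]) simp

text \<open>Kept out of \<open>computable_intros\<close>: the higher-order pattern
  \<open>G p (F p x)\<close> unifies with every goal, so the rule is applied only with
  \<open>G\<close> given.\<close>

lemma computable_comp:
  assumes "computable G" "computable F"
  shows "computable (\<lambda>p x. G p (F p x))"
proof -
  obtain c d where "\<And>p x. reval c p x = Some (G p x)" "\<And>p x. reval d p x = Some (F p x)"
    using assms unfolding computable_def by blast
  then show ?thesis
    unfolding computable_def by (intro exI[of _ "RComp c d"]) simp
qed

lemma computable_Suc [computable_intros]:
  assumes "computable F"
  shows "computable (\<lambda>p x. Suc (F p x))"
proof -
  have "computable (\<lambda>p x. Suc x)"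
    unfolding computable_def by (rule exI[of _ RSucc]) simp
  from computable_comp[OF this assms] show ?thesis .
qed

lemma computable_const [computable_intros]: "computable (\<lambda>p x. n)"
proof (induction n)
  case 0
  show ?case
    unfolding computable_def by (rule exI[of _ RZero]) simp
qed (rule computable_Suc)

lemma computable_left [computable_intros]:
  assumes "computable F"
  shows "computable (\<lambda>p x. left (F p x))"
proof -
  have "computable (\<lambda>p x. left x)"
    unfolding computable_def by (rule exI[of _ RFst]) simp
  from computable_comp[OF this assms] show ?thesis .
qed

lemma computable_right [computable_intros]:
  assumes "computable F"
  shows "computable (\<lambda>p x. right (F p x))"
proof -
  have "computable (\<lambda>p x. right x)"
    unfolding computable_def by (rule exI[of _ RSnd]) simp
  from computable_comp[OF this assms] show ?thesis .
qed

lemma computable_oracle [computable_intros]: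
  assumes "computable F"
  shows "computable (\<lambda>p x. p (F p x))"
proof -
  have "computable (\<lambda>p x. p x)"
    unfolding computable_def by (rule exI[of _ ROracle]) simp
  from computable_comp[OF this assms] show ?thesis .
qed

lemma computable_pair [computable_intros]:
  assumes "computable F" "computable G"
  shows "computable (\<lambda>p x. pair (F p x) (G p x))"
proof -
  obtain c d where "\<And>p x. reval c p x = Some (F p x)" "\<And>p x. reval d p x = Some (G p x)"
    using assms unfolding computable_def by blast
  then show ?thesis
    unfolding computable_def by (intro exI[of _ "RPair c d"]) simp
qed

text \<open>The parameter of \<open>RPrec\<close> is instantiated with the whole input
  \<open>x\<close>, so the step functional \<open>B\<close> receives input, counter and previous
  value packed into one number.\<close>

lemma computable_rec_nat:
  assumes "computable A" "computable B" "computable N"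
  shows "computable (\<lambda>p x. rec_nat (A p x) (\<lambda>n r. B p (pair x (pair n r))) (N p x))"
proof -
  obtain a b where a: "\<And>p x. reval a p x = Some (A p x)" and b: "\<And>p x. reval b p x = Some (B p x)"
    using assms(1,2) unfolding computable_def by blast
  have "rec_nat (Some (A p u)) (\<lambda>n r. Option.bind r (\<lambda>v. Some (B p (pair u (pair n v))))) n
      = Some (rec_nat (A p u) (\<lambda>n r. B p (pair u (pair n r))) n)" for p u n
    by (induction n) auto
  then have "computable (\<lambda>p y.
      rec_nat (A p (left y)) (\<lambda>n r. B p (pair (left y) (pair n r))) (right y))"
    unfolding computable_def by (intro exI[of _ "RPrec a b"]) (simp add: a b)
  from computable_comp[OF this computable_pair[OF computable_id assms(3)]]
  show ?thesis by simp
qed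

lemma computable_funpow:
  assumes "computable S" "computable N" "computable A"
  shows "computable (\<lambda>p x. (S p ^^ N p x) (A p x))"
proof -
  have "(S p ^^ n) y = rec_nat y (\<lambda>n r. S p r) n" for p n y
    by (induction n) auto
  moreover have "computable (\<lambda>p x. rec_nat (A p x) (\<lambda>n r. S p r) (N p x))"
    using computable_rec_nat[OF assms(3) _ assms(2), of "\<lambda>p z. S p (right (right z))"]
    by (simp add: computable_comp[OF assms(1)] computable_intros)
  ultimately show ?thesis by simp
qed

text \<open>A case distinction is a recursion whose step ignores both the counter and the previous
  value.\<close>

lemma computable_if_zero:
  assumes "computable C" "computable A" "computable B"
  shows "computable (\<lambda>p x. if C p x = 0 then A p x else B p x)"
proof -
  have "(if n = 0 then a else b) = rec_nat a (\<lambda>_ _. b) n" for n a b :: nat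
    by (cases n) auto
  moreover have "computable (\<lambda>p x. rec_nat (A p x) (\<lambda>_ _. B p x) (C p x))"
    using computable_rec_nat[OF assms(2) _ assms(1), of "\<lambda>p z. B p (left z)"]
    by (simp add: computable_comp[OF assms(3)] computable_intros)
  ultimately show ?thesis by simp
qed

section \<open>Arithmetic by iteration and recursion\<close>

lemma computable_add [computable_intros]:
  assumes "computable F" "computable G"
  shows "computable (\<lambda>p x. F p x + G p x)"
proof -
  have "(Suc ^^ n) m = m + n" for m n
    by (induction n) auto
  with computable_funpow[OF computable_Suc[OF computable_id] assms(2,1)] show ?thesis
    by (simp add: add.commute)
qed

lemma computable_diff [computable_intros]:
  assumes "computable F" "computable G"
  shows "computable (\<lambda>p x. F p x - G p x)"
proof -
  \<comment> \<open>A recursion that returns its counter is the predecessor, with 0 sent to 0;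
    iterating it gives truncated subtraction.\<close>
  have pred: "rec_nat 0 (\<lambda>n r. n) m = m - 1" for m :: nat
    by (cases m) auto
  have "computable (\<lambda>p x. x - 1)"
    using computable_rec_nat[OF computable_const[of 0] _ computable_id, of "\<lambda>p z. left (right z)"]
    by (simp add: computable_intros pred)
  moreover have "((\<lambda>k. k - 1) ^^ n) m = m - n" for m n :: nat
    by (induction n) auto
  ultimately show ?thesis
    using computable_funpow[of "\<lambda>p x. x - 1", OF _ assms(2,1)] by simp
qed

lemma computable_if_eq [computable_intros]:
  assumes "computable F" "computable G" "computable A" "computable B"
  shows "computable (\<lambda>p x. if F p x = G p x then A p x else B p x)"
proof -
  have "computable (\<lambda>p x. if (F p x - G p x) + (G p x - F p x) = 0 then A p x else B p x)"
    by (intro computable_if_zero computable_intros assms)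
  moreover have "(m - n) + (n - m) = 0 \<longleftrightarrow> m = n" for m n :: nat
    by auto
  ultimately show ?thesis by (simp only:)
qed

text \<open>The modulus is a fixed number. Counting up to the dividend, the remainder grows by one
  and is reset on reaching \<open>m\<close>; for \<open>m = 0\<close> it is never reset, which
  agrees with \<open>n mod 0 = n\<close>.\<close>

lemma computable_mod [computable_intros]:
  assumes "computable F"
  shows "computable (\<lambda>p x. F p x mod m)"
proof -
  have "n mod m = rec_nat 0 (\<lambda>_ r. if Suc r = m then 0 else Suc r) n" for n
    by (induction n) (simp_all add: mod_Suc)
  moreover have "computable (\<lambda>p x. rec_nat 0 (\<lambda>_ r. if Suc r = m then 0 else Suc r) (F p x))"
    using computable_rec_nat[OF computable_const[of 0] _ assms,
        of "\<lambda>p z. if Suc (right (right z)) = m then 0 else Suc (right (right z))"]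
    by (simp add: computable_intros cong: if_cong)
  ultimately show ?thesis by simp
qed

lemma computable_div [computable_intros]:
  assumes "computable F"
  shows "computable (\<lambda>p x. F p x div m)"
proof -
  have "n div m = rec_nat 0 (\<lambda>n q. if Suc n mod m = 0 then Suc q else q) n" for n
    by (induction n) (simp_all add: div_Suc)
  moreover have
    "computable (\<lambda>p x. rec_nat 0 (\<lambda>n q. if Suc n mod m = 0 then Suc q else q) (F p x))"
    using computable_rec_nat[OF computable_const[of 0] _ assms,
        of "\<lambda>p z. if Suc (left (right z)) mod m = 0 then Suc (right (right z)) else right (right z)"]
    by (simp add: computable_intros cong: if_cong)
  ultimately show ?thesis by simp
qed

section \<open>A universal functional\<close>

text \<open>
  A machine state is a pair of a stack and a current value; the empty stack is 0.  A frame is a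
  tag with arguments and says what to do with the current value: apply a code to it (tag 0),
  or resume the evaluation of a compound code that was waiting for it.
\<close>

abbreviation "push fr K \<equiv> Suc (pair fr K)"
abbreviation "run_frame e \<equiv> pair 0 e"
text \<open>The two pair frames await the first and the second component.
  \<open>prec_frame j u m n\<close> awaits the value at stage \<open>m\<close> of a recursion
  running up to \<open>n\<close>, and \<open>mu_frame k x m\<close> awaits the value of the search
  test at \<open>m\<close>.\<close>

abbreviation "pair1_frame j x \<equiv> pair 1 (pair j x)"
abbreviation "pair2_frame y \<equiv> pair 2 y"
abbreviation "prec_frame j u m n \<equiv> pair 3 (pair (pair j u) (pair m n))"
abbreviation "mu_frame k x m \<equiv> pair 4 (pair (pair k x) m)"

text \<open>\<open>t\<close> and \<open>k\<close> are the constructor number and the argument index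
  as decoded by \<open>code_of\<close>. The subcomputation due first is pushed last, above the frame
  that will use its value.\<close>

definition compound_step :: "nat \<Rightarrow> nat \<Rightarrow> nat \<Rightarrow> nat \<Rightarrow> nat" where
  "compound_step t k x K =
    (if t = 0 then pair (push (run_frame (left k)) (push (pair1_frame (right k) x) K)) x
     else if t = 1 then pair (push (run_frame (right k)) (push (run_frame (left k)) K)) x
     else if t = 2 then
       pair (push (run_frame (left k)) (push (prec_frame (right k) (left x) 0 (right x)) K)) (left x)
     else pair (push (run_frame k) (push (mu_frame k x 0) K)) (pair x 0))"

definition run_step :: "(nat \<Rightarrow> nat) \<Rightarrow> nat \<Rightarrow> nat \<Rightarrow> nat \<Rightarrow> nat" where
  "run_step g e x K =
    (if e = 0 then pair K 0 else if e = 1 then pair K (Suc x)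
     else if e = 2 then pair K (left x) else if e = 3 then pair K (right x)
     else if e = 4 then pair K (g x)
     else compound_step ((e - 5) mod 4) ((e - 5) div 4) x K)"

definition prec_step :: "nat \<Rightarrow> nat \<Rightarrow> nat \<Rightarrow> nat \<Rightarrow> nat \<Rightarrow> nat \<Rightarrow> nat" where
  "prec_step j u m n v K =
    (if m = n then pair K v
     else pair (push (run_frame j) (push (prec_frame j u (Suc m) n) K)) (pair u (pair m v)))"

definition mu_step :: "nat \<Rightarrow> nat \<Rightarrow> nat \<Rightarrow> nat \<Rightarrow> nat \<Rightarrow> nat" where
  "mu_step k x m v K =
    (if v = 0 then pair K m
     else pair (push (run_frame k) (push (mu_frame k x (Suc m)) K)) (pair x (Suc m)))"

definition frame_step :: "(nat \<Rightarrow> nat) \<Rightarrow> nat \<Rightarrow> nat \<Rightarrow> nat \<Rightarrow> nat \<Rightarrow> nat" where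
  "frame_step g t a v K =
    (if t = 0 then run_step g a v K
     else if t = 1 then pair (push (run_frame (left a)) (push (pair2_frame v) K)) (right a)
     else if t = 2 then pair K (pair a v)
     else if t = 3 then
       prec_step (left (left a)) (right (left a)) (left (right a)) (right (right a)) v K
     else mu_step (left (left a)) (right (left a)) (right a) v K)"

text \<open>A state with empty stack is a fixed point, so iterating past the end does no harm.
  \<open>left s - 1\<close> undoes the \<open>Suc\<close> of \<open>push\<close>.\<close>

definition step :: "(nat \<Rightarrow> nat) \<Rightarrow> nat \<Rightarrow> nat" where
  "step g s =
    (if left s = 0 then s
     else frame_step g (left (left (left s - 1))) (right (left (left s - 1))) (right s)
       (right (left s - 1)))"

text \<open>The machine may run on an oracle \<open>G p\<close> that is itself computed from
  \<open>p\<close>. This provides substitution into the oracle, for which codes have no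
  constructor.\<close>

lemma computable_step:
  assumes "computable G"
  shows "computable (\<lambda>p. step (G p))"
  unfolding step_def frame_step_def run_step_def compound_step_def prec_step_def mu_step_def
  by (intro computable_intros computable_comp[OF assms])

lemma step_halted: "left s = 0 \<Longrightarrow> step g s = s"
  by (simp add: step_def)

lemma step_push: "step g (pair (push (pair t a) K) v) = frame_step g t a v K"
  by (simp add: step_def)

section \<open>Correctness of the machine on convergent computations\<close>

definition reaches :: "(nat \<Rightarrow> nat) \<Rightarrow> nat \<Rightarrow> nat \<Rightarrow> bool" where
  "reaches g s s' \<longleftrightarrow> (\<exists>n. (step g ^^ n) s = s')"

lemma reaches_refl: "reaches g s s"
  unfolding reaches_def by (metis funpow_0)

lemma reaches_trans [trans]: "reaches g s s' \<Longrightarrow> reaches g s' s'' \<Longrightarrow> reaches g s s''"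
  unfolding reaches_def by (metis comp_apply funpow_add)

lemma reaches_step: "reaches g (step g s) s' \<Longrightarrow> reaches g s s'"
  unfolding reaches_def by (metis comp_apply funpow_Suc_right)

lemma reaches_push:
  "reaches g (frame_step g t a v K) s \<Longrightarrow> reaches g (pair (push (pair t a) K) v) s"
  by (rule reaches_step) (simp add: step_push)

lemma defined_downwards:
  assumes "\<And>m. h (Suc m) \<noteq> None \<Longrightarrow> h m \<noteq> None" "h n \<noteq> None" "m \<le> n"
  shows "h m \<noteq> None"
  using assms(3)
proof (induction m rule: inc_induct)
  case base
  show ?case by (rule assms(2))
next
  case (step m)
  show ?case by (rule assms(1)) (rule step.IH)
qed

text \<open>\<open>h\<close> lists the values of the recursion. The counter in the frame climbs to
  \<open>n\<close>, so the induction descends from \<open>n\<close>; \<open>strict\<close> makes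
  every earlier \<open>h m\<close> defined, so that \<open>the (h m)\<close> is a genuine
  value.\<close>

lemma reaches_prec:
  assumes body: "\<And>m w K. m < n \<Longrightarrow> h m \<noteq> None \<Longrightarrow> h (Suc m) = Some w \<Longrightarrow>
      reaches g (pair (push (run_frame j) K) (pair u (pair m (the (h m))))) (pair K w)"
    and strict: "\<And>m. h (Suc m) \<noteq> None \<Longrightarrow> h m \<noteq> None"
    and "m \<le> n" "h n = Some v"
  shows "reaches g (pair (push (prec_frame j u m n) K) (the (h m))) (pair K v)"
  using \<open>m \<le> n\<close>
proof (induction m rule: inc_induct)
  case base
  show ?case
    using assms(4) by (intro reaches_push) (simp add: frame_step_def prec_step_def reaches_refl)
next
  case (step m)
  have "h (Suc m) \<noteq> None"
    using \<open>m < n\<close> assms(4) by (simp add: defined_downwards[of h n "Suc m", OF strict])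
  then obtain w where w: "h (Suc m) = Some w"
    by blast
  with body[OF \<open>m < n\<close> strict w] step.IH
  have "reaches g (pair (push (run_frame j) (push (prec_frame j u (Suc m) n) K))
      (pair u (pair m (the (h m))))) (pair K v)"
    by (auto intro: reaches_trans)
  with \<open>m < n\<close> show ?case
    by (intro reaches_push) (simp add: frame_step_def prec_step_def)
qed

text \<open>Again by descent from \<open>n\<close>. By \<open>before\<close>, each earlier test
  converges to a nonzero value, which makes the machine move on to the next candidate.\<close>

lemma reaches_mu:
  assumes body: "\<And>m w K. f m = Some w \<Longrightarrow>
      reaches g (pair (push (run_frame k) K) (pair x m)) (pair K w)"
    and "f n = Some 0" and before: "\<And>m. m < n \<Longrightarrow> f m \<noteq> None \<and> f m \<noteq> Some 0"
    and "m \<le> n"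
  shows "reaches g (pair (push (run_frame k) (push (mu_frame k x m) K)) (pair x m)) (pair K n)"
  using \<open>m \<le> n\<close>
proof (induction m rule: inc_induct)
  case base
  have "reaches g (pair (push (mu_frame k x n) K) 0) (pair K n)"
    by (rule reaches_push) (simp add: frame_step_def mu_step_def reaches_refl)
  with body[OF \<open>f n = Some 0\<close>] show ?case
    by (rule reaches_trans)
next
  case (step m)
  obtain w where w: "f m = Some w" "w \<noteq> 0"
    using before[OF \<open>m < n\<close>] by auto
  have "reaches g (pair (push (mu_frame k x m) K) w) (pair K n)"
    using w(2) step.IH by (intro reaches_push) (simp add: frame_step_def mu_step_def)
  with body[OF w(1)] show ?case
    by (rule reaches_trans)
qed

text \<open>The machine handles indices, so the induction is on the index, whose components are
  smaller. The stack \<open>K\<close> stays arbitrary because subcomputations run above pending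
  frames.\<close>

lemma reaches_reval:
  "reval (code_of e) g x = Some v \<Longrightarrow> reaches g (pair (push (run_frame e) K) x) (pair K v)"
proof (induction e arbitrary: x v K rule: less_induct)
  case (less e)
  show ?case
  proof (cases "e < 5")
    case True
    then consider "e = 0" | "e = 1" | "e = 2" | "e = 3" | "e = 4"
      by linarith
    then show ?thesis
      using less.prems
      by cases (auto simp: code_of.simps frame_step_def run_step_def intro!: reaches_push reaches_refl)
  next
    case False
    define k t where "k = (e - 5) div 4" and "t = (e - 5) mod 4"
    define i j where "i = left k" and "j = right k"
    have "k < e"
      using False by (simp add: k_def)
    then have "i < e" "j < e"
      using fst_prod_decode_le[of k] snd_prod_decode_le[of k] by (auto simp: i_def j_def)
    note IH = less.IH[OF \<open>i < e\<close>] less.IH[OF \<open>j < e\<close>] less.IH[OF \<open>k < e\<close>]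
    have code: "code_of e = (if t = 0 then RPair (code_of i) (code_of j)
        else if t = 1 then RComp (code_of i) (code_of j)
        else if t = 2 then RPrec (code_of i) (code_of j) else RMu (code_of k))"
      using False by (subst code_of.simps) (simp add: Let_def k_def t_def i_def j_def)
    have "run_step g e x K = compound_step t k x K"
      using False by (simp add: run_step_def k_def t_def)
    moreover have "reaches g (compound_step t k x K) (pair K v)"
    proof -
      have "t < 4"
        by (simp add: t_def)
      then consider "t = 0" | "t = 1" | "t = 2" | "t = 3"
        by linarith
      then show ?thesis
      proof cases
        case 1
        then obtain y z where yz: "reval (code_of i) g x = Some y" "reval (code_of j) g x = Some z"
          "v = pair y z"
          using less.prems by (auto simp: code bind_eq_Some_conv)
        have "reaches g (pair (push (pair2_frame y) K) z) (pair K v)"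
          using yz(3) by (intro reaches_push) (simp add: frame_step_def reaches_refl)
        with IH(2)[OF yz(2)]
        have "reaches g (pair (push (run_frame j) (push (pair2_frame y) K)) x) (pair K v)"
          by (rule reaches_trans)
        then have "reaches g (pair (push (pair1_frame j x) K) y) (pair K v)"
          by (intro reaches_push) (simp add: frame_step_def)
        with IH(1)[OF yz(1)]
        have "reaches g (pair (push (run_frame i) (push (pair1_frame j x) K)) x) (pair K v)"
          by (rule reaches_trans)
        with 1 show ?thesis
          by (simp add: compound_step_def i_def j_def)
      next
        case 2
        then obtain y where y: "reval (code_of j) g x = Some y" "reval (code_of i) g y = Some v"
          using less.prems by (auto simp: code bind_eq_Some_conv)
        have "reaches g (pair (push (run_frame j) (push (run_frame i) K)) x) (pair K v)"
          using IH(2)[OF y(1)] IH(1)[OF y(2)] by (rule reaches_trans)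
        with 2 show ?thesis
          by (simp add: compound_step_def i_def j_def)
      next
        case 3
        define u n where "u = left x" and "n = right x"
        define h where "h = rec_nat (reval (code_of i) g u)
          (\<lambda>n r. Option.bind r (\<lambda>w. reval (code_of j) g (pair u (pair n w))))"
        have h: "h 0 = reval (code_of i) g u"
          "h (Suc m) = Option.bind (h m) (\<lambda>w. reval (code_of j) g (pair u (pair m w)))" for m
          by (simp_all add: h_def)
        have hn: "h n = Some v"
          using 3 less.prems by (simp add: code h_def u_def n_def)
        have strict: "h m \<noteq> None" if "h (Suc m) \<noteq> None" for m
          using that by (cases "h m") (simp_all add: h)
        have "h 0 \<noteq> None"
          using hn by (simp add: defined_downwards[of h n 0, OF strict])
        then have "reval (code_of i) g u = Some (the (h 0))"
          by (simp add: h)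
        from IH(1)[OF this]
        have "reaches g (pair (push (run_frame i) (push (prec_frame j u 0 n) K)) u)
            (pair (push (prec_frame j u 0 n) K) (the (h 0)))" .
        also have "reaches g \<dots> (pair K v)"
          by (rule reaches_prec[of n h, OF _ strict _ hn]) (auto simp: h intro!: IH(2))
        finally show ?thesis
          using 3 by (simp add: compound_step_def i_def j_def u_def n_def)
      next
        case 4
        define f where "f = (\<lambda>m. reval (code_of k) g (pair x m))"
        have "reval (code_of e) g x =
            (if \<exists>n. f n = Some 0 \<and> (\<forall>m<n. f m \<noteq> None) then Some (LEAST n. f n = Some 0) else None)"
          using 4 by (simp add: code f_def)
        with less.prems obtain n where n: "f n = Some 0" "\<forall>m<n. f m \<noteq> None"
          and v: "v = (LEAST n. f n = Some 0)"
          by (auto split: if_splits)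
        \<comment> \<open>The search returns the least zero \<open>v\<close> of \<open>f\<close>. It
          lies at or below \<open>n\<close>, so all tests before \<open>v\<close> are defined and
          nonzero, as \<open>reaches_mu\<close> requires.\<close>
        have "f v = Some 0"
          unfolding v by (rule LeastI) (rule n(1))
        moreover have "v \<le> n"
          unfolding v by (rule Least_le) (rule n(1))
        then have "f m \<noteq> None \<and> f m \<noteq> Some 0" if "m < v" for m
          using that n(2) not_less_Least[of m "\<lambda>n. f n = Some 0"] unfolding v by auto
        ultimately have
          "reaches g (pair (push (run_frame k) (push (mu_frame k x 0) K)) (pair x 0)) (pair K v)"
          by (intro reaches_mu[of f]) (auto simp: f_def intro!: IH(3))
        with 4 show ?thesis
          by (simp add: compound_step_def)
      qed
    qed
    ultimately show ?thesis
      by (intro reaches_push) (simp add: frame_step_def)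
  qed
qed

text \<open>Index, oracle and input may all depend on the data \<open>p\<close> and
  \<open>x\<close>. Agreement is claimed only where the simulated functional converges.\<close>

lemma universal_functional:
  assumes "computable G" "computable E" "computable X"
  shows "\<exists>c. \<forall>p x v. functional_of (E p x) (G p) (X p x) = Some v \<longrightarrow> reval c p x = Some v"
proof -
  define state where "state p x n = (step (G p) ^^ n) (pair (push (run_frame (E p x)) 0) (X p x))"
    for p x n
  have state: "computable (\<lambda>p z. state p (left z) (right z))"
    unfolding state_def
    by (intro computable_funpow computable_step computable_intros assms
        computable_comp[OF assms(2)] computable_comp[OF assms(3)])
  obtain a where a: "\<And>p z. reval a p z = Some (left (state p (left z) (right z)))"
    using computable_left[OF state] unfolding computable_def by blast
  obtain b where b: "\<And>p z. reval b p z = Some (right (state p (left z) (right z)))"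
    using computable_right[OF state] unfolding computable_def by blast
  obtain d where d: "\<And>p x. reval d p x = Some x"
    using computable_id unfolding computable_def by blast
  \<comment> \<open>\<open>RMu a\<close> finds the first stage with empty stack,
    \<open>RPair d\<close> keeps \<open>x\<close> beside it, and \<open>b\<close> reads the value
    held at that stage.\<close>
  have "reval (RComp b (RPair d (RMu a))) p x = Some v"
    if conv: "functional_of (E p x) (G p) (X p x) = Some v" for p x v
  proof -
    obtain N where N: "state p x N = pair 0 v"
      using reaches_reval[OF conv[unfolded functional_of_def], of 0]
      unfolding reaches_def state_def by blast
    define m where "m = (LEAST n. left (state p x n) = 0)"
    have halted: "left (state p x m) = 0"
      unfolding m_def by (rule LeastI[of _ N]) (simp add: N)
    have "m \<le> N"
      unfolding m_def by (rule Least_le) (simp add: N)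
    \<comment> \<open>Halted states persist, so the first halted stage \<open>m\<close> already
      shows the state known at stage \<open>N\<close>.\<close>
    have "state p x (m + n) = state p x m" for n
      using halted by (induction n) (simp_all add: state_def step_halted)
    from this[of "N - m"] have "state p x m = pair 0 v"
      using \<open>m \<le> N\<close> N by simp
    moreover have "reval (RMu a) p x = Some m"
      using N by (auto simp: a m_def intro: exI[of _ N])
    ultimately show ?thesis
      by (simp add: b d del: reval.simps(9))
  qed
  then show ?thesis by blast
qed

section \<open>The first-order part\<close>

lemma computable_maps_to:
  assumes "computable F"
  obtains \<Phi> where "Turing_functional \<Phi>" "\<And>f. maps_to \<Phi> f (F f)"
  using assms unfolding computable_def Turing_functional_def maps_to_def by blast

lemma embed_0 [simp]: "embed y 0 = y"
  by (simp add: embed_def)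

lemma first_order_first_order_part: "first_order (first_order_part P)"
  unfolding first_order_def first_order_part_def by auto

text \<open>Membership of \<open>h\<close> in \<open>pdom P\<close> supplies some solution
  \<open>g\<close>, and the value computed from it witnesses nonemptiness.\<close>

lemma pdom_first_order_part:
  assumes "fop_instance P f i j"
  shows "join f (join (embed i) (embed j)) \<in> pdom (first_order_part P)"
proof -
  obtain h g where "maps_to (functional_of i) f h" "g \<in> P h" "functional_of j (join f g) 0 \<noteq> None"
    using assms unfolding fop_instance_def pdom_def by blast
  then obtain y where
    "maps_to (functional_of i) f h \<and> g \<in> P h \<and> functional_of j (join f g) 0 = Some y"
    by blast
  with assms have "embed y \<in> first_order_part P (join f (join (embed i) (embed j)))"
    unfolding first_order_part_def by blast
  then show ?thesis
    unfolding pdom_def by blast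
qed

text \<open>\<open>f\<close> is read off the even positions, and the indices off positions 1 and 3.
  Injectivity identifies the triple hidden by the existential in
  \<open>first_order_part\<close>.\<close>

lemma join_embed_eq_iff:
  "join f (join (embed i) (embed j)) = join f' (join (embed i') (embed j')) \<longleftrightarrow>
    f = f' \<and> i = i' \<and> j = j'" (is "?l = ?r \<longleftrightarrow> _")
proof
  assume eq: "?l = ?r"
  have "f n = f' n" for n
    using fun_cong[OF eq, of "2 * n"] by (simp add: join_def)
  moreover have "i = i'"
    using fun_cong[OF eq, of 1] by (simp add: join_def)
  moreover have "j = j'"
    using fun_cong[OF eq, of 3] by (simp add: join_def)
  ultimately show "f = f' \<and> i = i' \<and> j = j'" by blast
qed simp

text \<open>The forward functional attaches the fixed indices \<open>i\<close> and \<open>j\<close>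
  to \<open>f\<close>. The backward one is the identity, which is why the reduction is
  strong.\<close>

lemma strong_Weihrauch_le_first_order_part:
  assumes "first_order Q" "Q \<le>\<^sub>W P"
  shows "Q \<le>\<^sub>s\<^sub>W first_order_part P"
proof -
  obtain i j where red: "\<And>f. f \<in> pdom Q \<Longrightarrow> \<exists>h\<in>pdom P. maps_to (functional_of i) f h \<and>
      (\<forall>g\<in>P h. \<exists>k\<in>Q f. maps_to (functional_of j) (join f g) k)"
    using assms(2) unfolding Weihrauch_le_def Turing_functional_iff_index by blast
  \<comment> \<open>This is the nested join written out with \<open>mod\<close> and
    \<open>div\<close>, a form covered by \<open>computable_intros\<close>.\<close>
  have "computable (\<lambda>f n. if n mod 2 = 0 then f (n div 2)
      else if n div 2 mod 2 = 0 then if n div 2 div 2 = 0 then i else 0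
      else if n div 2 div 2 = 0 then j else 0)"
    by (intro computable_intros)
  then have "computable (\<lambda>f. join f (join (embed i) (embed j)))"
    unfolding join_def embed_def even_iff_mod_2_eq_zero .
  then obtain \<Phi> where \<Phi>: "Turing_functional \<Phi>"
      "\<And>f. maps_to \<Phi> f (join f (join (embed i) (embed j)))"
    by (rule computable_maps_to) blast
  have id: "Turing_functional (reval ROracle)" "maps_to (reval ROracle) g g" for g
    by (auto simp: Turing_functional_def maps_to_def)
  have "join f (join (embed i) (embed j)) \<in> pdom (first_order_part P)
      \<and> first_order_part P (join f (join (embed i) (embed j))) \<subseteq> Q f" if f: "f \<in> pdom Q" for f
  proof
    obtain h where h: "h \<in> pdom P" "maps_to (functional_of i) f h"
      "\<And>g. g \<in> P h \<Longrightarrow> \<exists>k\<in>Q f. maps_to (functional_of j) (join f g) k"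
      using red[OF f] by blast
    have "functional_of j (join f g) 0 \<noteq> None" if "g \<in> P h" for g
      using h(3)[OF that] by (auto simp: maps_to_def)
    with h(1,2) show "join f (join (embed i) (embed j)) \<in> pdom (first_order_part P)"
      by (intro pdom_first_order_part) (auto simp: fop_instance_def)
    have "embed y \<in> Q f" if "maps_to (functional_of i) f h'" "g \<in> P h'"
      "functional_of j (join f g) 0 = Some y" for h' g y
    proof -
      have "h' = h"
        using that(1) h(2) by (auto simp: maps_to_def)
      with h(3) that(2) obtain k where k: "k \<in> Q f" "maps_to (functional_of j) (join f g) k"
        by blast
      obtain z where "k = embed z"
        using assms(1) f k(1) unfolding first_order_def by blast
      with k that(3) show ?thesis
        by (metis embed_0 maps_to_def option.inject)
    qed
    then show "first_order_part P (join f (join (embed i) (embed j))) \<subseteq> Q f"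
      unfolding first_order_part_def by (auto simp: join_embed_eq_iff)
  qed
  then have "\<exists>h\<in>pdom (first_order_part P). maps_to \<Phi> f h \<and>
      (\<forall>g\<in>first_order_part P h. \<exists>k\<in>Q f. maps_to (reval ROracle) g k)" if "f \<in> pdom Q" for f
    using that \<Phi>(2) id(2) by (meson subsetD)
  with \<Phi>(1) id(1) show ?thesis
    unfolding strong_Weihrauch_le_def by (meson ballI)
qed

text \<open>The backward functional expects oracle \<open>g\<close> but is handed
  \<open>join f g\<close>; it is simulated on the odd half of the given oracle.\<close>

lemma strong_Weihrauch_le_imp_le:
  assumes "Q \<le>\<^sub>s\<^sub>W P"
  shows "Q \<le>\<^sub>W P"
proof -
  obtain \<Phi> d where \<Phi>: "Turing_functional \<Phi>"
    and red: "\<forall>f\<in>pdom Q. \<exists>h\<in>pdom P. maps_to \<Phi> f h \<and> (\<forall>g\<in>P h. \<exists>k\<in>Q f. maps_to (reval d) g k)"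
    using assms unfolding strong_Weihrauch_le_def Turing_functional_def by blast
  obtain i where i: "code_of i = d"
    by (metis surj_code_of surjD)
  have "\<exists>c. \<forall>q x v. functional_of i (\<lambda>n. q (Suc (n + n))) x = Some v \<longrightarrow> reval c q x = Some v"
    by (rule universal_functional) (intro computable_intros)+
  then obtain c where c:
    "\<And>q x v. functional_of i (\<lambda>n. q (Suc (n + n))) x = Some v \<Longrightarrow> reval c q x = Some v"
    by blast
  have "(\<lambda>n. join f g (Suc (n + n))) = g" for f g
    by (simp add: join_def fun_eq_iff)
  with c[of "join _ _"] have "maps_to (reval c) (join f g) k" if "maps_to (reval d) g k" for f g k
    using that i by (simp add: maps_to_def functional_of_def)
  then have "\<forall>f\<in>pdom Q. \<exists>h\<in>pdom P. maps_to \<Phi> f h \<and>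
      (\<forall>g\<in>P h. \<exists>k\<in>Q f. maps_to (reval c) (join f g) k)"
    using red by meson
  moreover have "Turing_functional (reval c)"
    unfolding Turing_functional_def by blast
  ultimately show ?thesis
    using \<Phi> unfolding Weihrauch_le_def by blast
qed

text \<open>The functionals to be run are named inside the instance, so both directions use
  universality. The instance condition guarantees convergence at 0, and the value found is a
  solution by definition.\<close>

lemma first_order_part_Weihrauch_le: "first_order_part P \<le>\<^sub>W P"
proof -
  \<comment> \<open>In the code \<open>p\<close> of a triple, the indices sit at positions 1 and 3 and the first component
    at the even positions; in \<open>join p g\<close> the second index is therefore at position 6.\<close>
  have "\<exists>c. \<forall>p x v. functional_of (p 1) (\<lambda>n. p (n + n)) x = Some v \<longrightarrow> reval c p x = Some v"
    by (rule universal_functional) (intro computable_intros)+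
  then obtain c where c:
    "\<And>p x v. functional_of (p 1) (\<lambda>n. p (n + n)) x = Some v \<Longrightarrow> reval c p x = Some v"
    by blast
  \<comment> \<open>For \<open>q = join p g\<close> this oracle is \<open>join f g\<close>: at even
    \<open>n\<close>, \<open>q (n + n)\<close> is \<open>p n\<close>, which is
    \<open>f (n div 2)\<close>; at odd \<open>n\<close>, \<open>q n\<close> is already the value of
    \<open>g\<close>.\<close>
  have "\<exists>d. \<forall>q x v. functional_of (q 6) (\<lambda>n. if n mod 2 = 0 then q (n + n) else q n) 0 = Some v
      \<longrightarrow> reval d q x = Some v"
    by (rule universal_functional) (intro computable_intros)+
  then obtain d where d: "\<And>q x v.
      functional_of (q 6) (\<lambda>n. if n mod 2 = 0 then q (n + n) else q n) 0 = Some v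
      \<Longrightarrow> reval d q x = Some v"
    by blast
  \<comment> \<open>\<open>b\<close> pads a number with zeros: from a value and a position it
    computes the entry of the embedded value there.\<close>
  obtain b where b: "\<And>p z. reval b p z = Some (embed (left z) (right z))"
  proof -
    have "computable (\<lambda>p z. if right z = 0 then left z else 0)"
      by (intro computable_intros)
    then show thesis
      using that unfolding computable_def embed_def by blast
  qed
  obtain r where r: "\<And>p x. reval r p x = Some x"
    using computable_id unfolding computable_def by blast
  have "\<exists>h\<in>pdom P. maps_to (reval c) p h \<and>
      (\<forall>g\<in>P h. \<exists>k\<in>first_order_part P p. maps_to (reval (RComp b (RPair d r))) (join p g) k)"
    if p_dom: "p \<in> pdom (first_order_part P)" for p
  proof -
    obtain k where "k \<in> first_order_part P p"
      using p_dom unfolding pdom_def by blast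
    then obtain f i j where p: "p = join f (join (embed i) (embed j))" and "fop_instance P f i j"
      unfolding first_order_part_def by blast
    then obtain h where h: "h \<in> pdom P" "maps_to (functional_of i) f h"
      "\<And>g. g \<in> P h \<Longrightarrow> functional_of j (join f g) 0 \<noteq> None"
      unfolding fop_instance_def by blast
    have "p 1 = i" "(\<lambda>n. p (n + n)) = f"
      by (simp_all add: p join_def fun_eq_iff)
    then have "maps_to (reval c) p h"
      using h(2) c[of p] by (simp add: maps_to_def)
    moreover have "\<exists>k\<in>first_order_part P p. maps_to (reval (RComp b (RPair d r))) (join p g) k"
      if g: "g \<in> P h" for g
    proof -
      obtain y where y: "functional_of j (join f g) 0 = Some y"
        using h(3)[OF g] by blast
      have "join p g 6 = j"
        "(\<lambda>n. if n mod 2 = 0 then join p g (n + n) else join p g n) = join f g"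
        by (auto simp: p join_def fun_eq_iff even_iff_mod_2_eq_zero)
      then have "reval d (join p g) x = Some y" for x
        using d[of "join p g"] y by simp
      then have "maps_to (reval (RComp b (RPair d r))) (join p g) (embed y)"
        by (simp add: maps_to_def b r)
      moreover have "embed y \<in> first_order_part P p"
        using p \<open>fop_instance P f i j\<close> h(2) g y unfolding first_order_part_def by blast
      ultimately show ?thesis by blast
    qed
    ultimately show ?thesis using h(1) by blast
  qed
  moreover have "Turing_functional (reval a)" for a
    unfolding Turing_functional_def by blast
  ultimately show ?thesis
    unfolding Weihrauch_le_def
    by (intro exI[of _ "reval c"] exI[of _ "reval (RComp b (RPair d r))"]) simp
qed

theorem theorem2p2:
  fixes P :: problem
  shows "(\<forall>Q. first_order Q \<longrightarrow> Q \<le>\<^sub>W P \<longrightarrow> Q \<le>\<^sub>s\<^sub>W first_order_part P) \<and>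
    (Weihrauch_greatest {Q. first_order Q \<and> Q \<le>\<^sub>W P} (first_order_part P) \<and>
     (\<forall>M. Weihrauch_greatest {Q. first_order Q \<and> Q \<le>\<^sub>W P} M \<longrightarrow> first_order_part P \<equiv>\<^sub>W M))"
proof -
  have "Weihrauch_greatest {Q. first_order Q \<and> Q \<le>\<^sub>W P} (first_order_part P)"
    unfolding Weihrauch_greatest_def
    by (simp add: first_order_first_order_part first_order_part_Weihrauch_le
        strong_Weihrauch_le_imp_le strong_Weihrauch_le_first_order_part)
  \<comment> \<open>Any two greatest elements reduce to each other, hence the equivalence with every
    such \<open>M\<close>.\<close>
  then show ?thesis
    using strong_Weihrauch_le_first_order_part
    unfolding Weihrauch_greatest_def Weihrauch_equiv_def by blast
qed

end
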